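(* Let $n\ge 1$ be an integer, let $a,b,r>0$ be real constants, let $\boldsymbol\mu\in\mathbb{R}^n$, and let $\mathbf{\Sigma}$ be a symmetric positive definite $n\times n$ real matrix. Let $$g(u)=\frac{\exp(-bu)}{(1+\exp(-au))^r},\quad u\ge 0,$$ and let $d_n$ be the normalizing constant for which $$f(\mathbf{x})=d_n|\mathbf{\Sigma}|^{-\frac12}g\big((\mathbf{x}-\boldsymbol\mu)^{T}\mathbf{\Sigma}^{-1}(\mathbf{x}-\boldsymbol\mu)\big),\quad \mathbf{x}\in\mathbb{R}^n,$$ is a probability density function on $\mathbb{R}^n$. Then $$d_n=\left(\frac{a}{\pi}\right)^{\frac n2}\left[\Phi^*_{r}\left(-1,\frac n2,\frac ba\right)\right]^{-1},$$ where $\Phi^*_r$ is the generalized Hurwitz-Lerch Zeta function.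
   Context: The generalized Hurwitz-Lerch Zeta function is $$\Phi^*_{\mu}(z,s,\alpha)=\frac{1}{\Gamma(\mu)}\sum_{k=0}^{\infty}\frac{\Gamma(\mu+k)}{k!}\frac{z^k}{(k+\alpha)^s},$$ with the integral representation $$\Phi^*_{\mu}(z,s,\alpha)=\frac{1}{\Gamma(s)}\int_0^{\infty}\frac{t^{s-1}e^{-\alpha t}}{(1-ze^{-t})^{\mu}}\,dt,$$ where $\mathrm{Re}(\alpha)>0$, and $\mathrm{Re}(s)>0$ when $|z|\le 1$, $z\ne 1$ ($\mathrm{Re}(s)>1$ when $z=1$). When the series does not converge (as can happen at $z=-1$), $\Phi^*_\mu$ is understood through the integral representation. *)

theory Defs
  imports "HOL-Analysis.Analysis"
begin

text \<open>
  The generalized Hurwitz--Lerch zeta function, with principal complex powers.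
  Where the series diverges (e.g. at \<open>z = -1\<close> when \<open>Re s \<le> Re \<mu> - 1\<close>), the value is that of the
  integral representation. Convergence is that of the partial sums, so it may be conditional.
  For \<open>Re \<alpha> > 0\<close> and \<open>norm z \<le> 1\<close> all bases of powers lie in the open right half-plane.
\<close>

definition HL_term :: "complex \<Rightarrow> complex \<Rightarrow> complex \<Rightarrow> complex \<Rightarrow> nat \<Rightarrow> complex" where
  "HL_term \<mu> z s \<alpha> k = Gamma (\<mu> + of_nat k) / fact k * (z ^ k / (of_nat k + \<alpha>) powr s)"

definition HL_zeta :: "complex \<Rightarrow> complex \<Rightarrow> complex \<Rightarrow> complex \<Rightarrow> complex" where
  "HL_zeta \<mu> z s \<alpha> =
     (if summable (HL_term \<mu> z s \<alpha>)
      then 1 / Gamma \<mu> * (\<Sum>k. HL_term \<mu> z s \<alpha> k)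
      else 1 / Gamma s *
        (LBINT t:{0<..}. of_real t powr (s - 1) * exp (- \<alpha> * of_real t)
                           / (1 - z * exp (- of_real t)) powr \<mu>))"

definition symmetric_positive_definite :: "real ^ 'n ^ 'n \<Rightarrow> bool" where
  "symmetric_positive_definite A \<longleftrightarrow>
     transpose A = A \<and> (\<forall>x. x \<noteq> 0 \<longrightarrow> x \<bullet> (A *v x) > 0)"

definition is_pdf :: "('a::euclidean_space \<Rightarrow> real) \<Rightarrow> bool" where
  "is_pdf f \<longleftrightarrow> (\<forall>x. 0 \<le> f x) \<and> has_bochner_integral lborel f 1"

definition logistic_generator :: "real \<Rightarrow> real \<Rightarrow> real \<Rightarrow> real \<Rightarrow> real" where
  "logistic_generator a b r u = exp (- b * u) / (1 + exp (- a * u)) powr r"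

definition elliptical_function ::
  "real \<Rightarrow> (real \<Rightarrow> real) \<Rightarrow> real ^ 'n \<Rightarrow> real ^ 'n ^ 'n \<Rightarrow> real ^ 'n \<Rightarrow> real" where
  "elliptical_function d g \<mu> \<Sigma> x =
     d * det \<Sigma> powr (- 1 / 2) * g ((x - \<mu>) \<bullet> (matrix_inv \<Sigma> *v (x - \<mu>)))"

end

theory Submission
  imports Defs
begin

text \<open>
  The integral of \<open>h(x\<^sup>T A x)\<close> over \<open>\<real>\<^sup>n\<close> is reduced to that of \<open>h(|x|\<^sup>2)\<close> by completing squares: each
  step is a shear, which preserves Lebesgue measure and the determinant of the form, and the
  diagonal case is a rescaling of the axes. The volume of balls turns the radial integral into
  \<open>\<pi>\<^bsup>n/2\<^esup>/\<Gamma>(n/2) \<integral> u\<^bsup>n/2-1\<^esup> h(u) du\<close>, which for the logistic generator is, after \<open>t = a u\<close>, the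
  integral representation of the Hurwitz--Lerch function at \<open>-1\<close>. When the series at \<open>-1\<close>
  converges, possibly only conditionally, it agrees with the integral: expand \<open>(1 + x e\<^bsup>-t\<^esup>)\<^bsup>-r\<^esup>\<close>
  for \<open>x < 1\<close> and let \<open>x \<rightarrow> 1\<close>, using Abel's theorem for the series and dominated convergence
  for the integral.
\<close>

section \<open>Integrals of functions of a quadratic form\<close>

text \<open>By Fubini the coordinate along \<open>k\<close> can be integrated first. On each line
  parallel to \<open>k\<close> the function \<open>\<phi>\<close> is constant, so there the shear is
  a translation, which preserves one-dimensional Lebesgue measure. Nonnegative integrals need no
  integrability argument.\<close>

lemma nn_integral_lborel_shear:
  fixes k :: "'a::euclidean_space" and \<phi> :: "'a \<Rightarrow> real" and f :: "'a \<Rightarrow> ennreal"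
  assumes k: "k \<in> Basis"
    and [measurable]: "\<phi> \<in> borel_measurable borel" "f \<in> borel_measurable borel"
    and inv: "\<And>x c. \<phi> (x + c *\<^sub>R k) = \<phi> x"
  shows "(\<integral>\<^sup>+x. f (x + \<phi> x *\<^sub>R k) \<partial>lborel) = (\<integral>\<^sup>+x. f x \<partial>lborel)"
proof -
  interpret product_sigma_finite "\<lambda>b::'a. lborel :: real measure"
    by standard
  define B where "B = Basis - {k}"
  have B: "finite B" "k \<notin> B" "Basis = insert k B"
    using k by (auto simp: B_def)
  define T where "T = (\<lambda>p::'a \<Rightarrow> real. \<Sum>b\<in>B. p b *\<^sub>R b)"
  have T: "(\<Sum>b\<in>Basis. p b *\<^sub>R b) = p k *\<^sub>R k + T p" for p
    by (subst B(3), subst sum.insert) (use B in \<open>auto simp: T_def\<close>)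
  have Tu: "T (p(k := y)) = T p" for p y
    using B by (auto simp: T_def intro!: sum.cong)
  have split: "(\<integral>\<^sup>+x. g x \<partial>lborel) =
      (\<integral>\<^sup>+p. (\<integral>\<^sup>+y. g (y *\<^sub>R k + T p) \<partial>lborel) \<partial>Pi\<^sub>M B (\<lambda>_. lborel))"
    if [measurable]: "g \<in> borel_measurable borel" for g :: "'a \<Rightarrow> ennreal"
  proof -
    have "(\<integral>\<^sup>+x. g x \<partial>lborel)
        = (\<integral>\<^sup>+p. g (\<Sum>b\<in>Basis. p b *\<^sub>R b) \<partial>Pi\<^sub>M (insert k B) (\<lambda>_. lborel))"
      by (subst lborel_eq) (simp add: nn_integral_distr B(3))
    also have "\<dots> = (\<integral>\<^sup>+p. (\<integral>\<^sup>+y. g (\<Sum>b\<in>Basis. (p(k := y)) b *\<^sub>R b) \<partial>lborel)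
        \<partial>Pi\<^sub>M B (\<lambda>_. lborel))"
      using B(1,2) by (rule product_nn_integral_insert) (simp add: B(3))
    finally show ?thesis
      by (simp only: T Tu fun_upd_same)
  qed
  \<comment> \<open>The invariance of \<open>\<phi>\<close> enters only here: it turns the
    displacement into \<open>\<phi> (T p)\<close>, which is free of the integration variable
    \<open>y\<close>.\<close>
  have shift: "(y *\<^sub>R k + T p) + \<phi> (y *\<^sub>R k + T p) *\<^sub>R k = (y + \<phi> (T p)) *\<^sub>R k + T p" for y p
    using inv[of "T p" y] by (simp add: algebra_simps)
  have "(\<integral>\<^sup>+x. f (x + \<phi> x *\<^sub>R k) \<partial>lborel) =
      (\<integral>\<^sup>+p. (\<integral>\<^sup>+y. f ((y + \<phi> (T p)) *\<^sub>R k + T p) \<partial>lborel) \<partial>Pi\<^sub>M B (\<lambda>_. lborel))"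
    by (subst split, measurable) (simp only: shift)
  also have "\<dots> = (\<integral>\<^sup>+p. (\<integral>\<^sup>+y. f (y *\<^sub>R k + T p) \<partial>lborel) \<partial>Pi\<^sub>M B (\<lambda>_. lborel))"
  proof (rule nn_integral_cong)
    fix p :: "'a \<Rightarrow> real"
    show "(\<integral>\<^sup>+y. f ((y + \<phi> (T p)) *\<^sub>R k + T p) \<partial>lborel) = (\<integral>\<^sup>+y. f (y *\<^sub>R k + T p) \<partial>lborel)"
      using nn_integral_real_affine[of "\<lambda>y. f (y *\<^sub>R k + T p)" 1 "\<phi> (T p)"]
      by (simp add: add.commute)
  qed
  also have "\<dots> = (\<integral>\<^sup>+x. f x \<partial>lborel)"
    by (rule split[symmetric]) simp
  finally show ?thesis .
qed

text \<open>As \<open>v $ k = 0\<close>, the vector \<open>v\<close> lies in the span of the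
  identity rows other than row \<open>k\<close>, and adding such a vector to row \<open>k\<close>
  leaves the determinant unchanged. This makes the shear below unimodular.\<close>

lemma det_elementary_row:
  fixes v :: "real ^ 'n"
  assumes "v $ k = 0"
  shows "det (\<chi> i. if i = k then axis k 1 + v else axis i 1) = (1 :: real)"
proof -
  have row: "row i (mat 1) = (axis i 1 :: real ^ 'n)" for i
    by (simp add: row_def mat_def axis_def vec_eq_iff)
  have "v = (\<Sum>i\<in>UNIV. v $ i *s axis i 1)"
    by (simp add: basis_expansion)
  also have "\<dots> \<in> vec.span {row j (mat 1 :: real ^ 'n ^ 'n) |j. j \<noteq> k}"
  proof (rule vec.span_sum)
    fix i
    show "v $ i *s axis i 1 \<in> vec.span {row j (mat 1 :: real ^ 'n ^ 'n) |j. j \<noteq> k}"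
    proof (cases "i = k")
      case True
      then show ?thesis using assms by (simp add: vec.span_zero)
    next
      case False
      then show ?thesis by (intro vec.span_scale vec.span_base) (auto simp: row)
    qed
  qed
  finally have "det (\<chi> i. if i = k then row k (mat 1) + v else row i (mat 1)) = det (mat 1 :: real ^ 'n ^ 'n)"
    by (rule det_row_span)
  then show ?thesis by (simp add: row cong: if_cong)
qed

lemma symmetric_positive_definite_diagonal_pos:
  assumes "symmetric_positive_definite A"
  shows "A $ i $ i > 0"
proof -
  have "axis i 1 \<bullet> (A *v axis i 1) > 0"
    using assms by (simp add: symmetric_positive_definite_def)
  then show ?thesis
    by (simp add: inner_axis' matrix_vector_mul_component inner_axis)
qed

text \<open>Dividing the i-th coordinate by \<open>sqrt (A $ i $ i)\<close> turns the form into the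
  squared norm. The Jacobian is the product of these factors, and the determinant of a diagonal
  matrix is the product of its entries.\<close>

lemma nn_integral_diagonal_form:
  fixes A :: "real ^ 'n ^ 'n" and h :: "real \<Rightarrow> ennreal"
  assumes diag: "\<And>i j. i \<noteq> j \<Longrightarrow> A $ i $ j = 0" and pos: "\<And>i. A $ i $ i > 0"
    and [measurable]: "h \<in> borel_measurable borel"
  shows "(\<integral>\<^sup>+x. h (x \<bullet> (A *v x)) \<partial>lborel) = ennreal (1 / sqrt (det A)) * (\<integral>\<^sup>+x. h ((x :: real ^ 'n) \<bullet> x) \<partial>lborel)"
proof -
  \<comment> \<open>\<open>lborel_affine_euclidean\<close> wants scaling factors indexed by basis
    vectors; on the vector \<open>axis i 1\<close> the form returns the diagonal entry.\<close>
  define c :: "real ^ 'n \<Rightarrow> real" where "c j = 1 / sqrt (j \<bullet> (A *v j))" for j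
  have c_axis: "c (axis i 1) = 1 / sqrt (A $ i $ i)" for i
    by (simp add: c_def inner_axis' matrix_vector_mul_component inner_axis)
  have Basis: "Basis = range (\<lambda>i. axis i 1 :: real ^ 'n)"
    by (auto simp: Basis_vec_def)
  have inj: "inj (\<lambda>i. axis i 1 :: real ^ 'n)"
    by (auto simp: inj_on_def axis_eq_axis)
  \<comment> \<open>The summand 0 is the translation part of the affine map in that same
    theorem.\<close>
  define T where "T x = 0 + (\<Sum>j\<in>Basis. (c j * (x \<bullet> j)) *\<^sub>R j)" for x :: "real ^ 'n"
  have T: "T x $ i = x $ i / sqrt (A $ i $ i)" for x i
  proof -
    have "T x $ i = T x \<bullet> axis i 1"
      by (simp add: inner_axis)
    also have "\<dots> = c (axis i 1) * (x \<bullet> axis i 1)"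
      unfolding T_def by (simp add: inner_sum_left_Basis axis_in_Basis_iff)
    finally show ?thesis by (simp add: c_axis inner_axis)
  qed
  have Av: "(A *v x) $ i = A $ i $ i * x $ i" for x i
    unfolding matrix_vector_mult_def
    by (simp, subst sum.remove[of _ i]) (auto simp: diag intro!: sum.neutral)
  have form: "T x \<bullet> (A *v T x) = x \<bullet> x" for x
    unfolding inner_vec_def using pos less_imp_neq[OF pos]
    by (intro sum.cong refl) (simp add: Av T field_simps order_less_imp_le flip: power2_eq_square)
  have "(\<Prod>j\<in>Basis. \<bar>c j\<bar>) = (\<Prod>i\<in>UNIV. \<bar>1 / sqrt (A $ i $ i)\<bar>)"
    unfolding Basis by (simp add: prod.reindex[OF inj] c_axis)
  also have "\<dots> = 1 / sqrt (\<Prod>i\<in>UNIV. A $ i $ i)"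
  proof -
    have "(\<Prod>i\<in>I. sqrt (A $ i $ i)) = sqrt (\<Prod>i\<in>I. A $ i $ i)" for I
      by (induction I rule: infinite_finite_induct) (auto simp: real_sqrt_mult)
    then show ?thesis
      using pos by (simp add: prod_dividef order_less_imp_le abs_of_nonneg)
  qed
  also have "\<dots> = 1 / sqrt (det A)"
    using diag by (simp add: det_diagonal)
  finally have prod: "(\<Prod>j\<in>Basis. \<bar>c j\<bar>) = 1 / sqrt (det A)" .
  have "lborel = density (distr lborel borel T) (\<lambda>_. (\<Prod>j\<in>Basis. \<bar>c j\<bar>))"
    unfolding T_def using pos
    by (intro lborel_affine_euclidean) (auto simp: Basis c_axis less_imp_neq[OF pos, symmetric])
  then have lb: "lborel = density (distr lborel borel T) (\<lambda>_. ennreal (1 / sqrt (det A)))"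
    by (simp only: prod)
  have [measurable]: "T \<in> borel_measurable borel"
    unfolding T_def by measurable
  have [measurable]: "(\<lambda>x. A *v x) \<in> borel_measurable borel"
    by (intro borel_measurable_continuous_onI matrix_vector_mult_linear_continuous_on)
  show ?thesis
    by (subst lb) (simp add: nn_integral_density nn_integral_distr nn_integral_cmult form)
qed

text \<open>Unimodular shears bring the form to diagonal shape one variable at a time, keeping both
  the integral and the determinant. Positivity of the determinant is carried along because the
  diagonal case supplies it at the same time, with no appeal to eigenvalues.\<close>

lemma symmetric_positive_definite_nn_integral:
  fixes A :: "real ^ 'n ^ 'n" and h :: "real \<Rightarrow> ennreal"
  assumes "symmetric_positive_definite A"
    and h [measurable]: "h \<in> borel_measurable borel"
  shows "det A > 0 \<and> (\<integral>\<^sup>+x. h (x \<bullet> (A *v x)) \<partial>lborel)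
    = ennreal (1 / sqrt (det A)) * (\<integral>\<^sup>+x. h ((x :: real ^ 'n) \<bullet> x) \<partial>lborel)"
    (is "?P A")
proof -
  \<comment> \<open>\<open>S\<close> holds the indices whose rows may still have off-diagonal
    entries; every induction step clears one such row.\<close>
  have "?P A" if "finite S" "symmetric_positive_definite A" "\<And>i j. i \<notin> S \<Longrightarrow> j \<noteq> i \<Longrightarrow> A $ i $ j = 0"
    for S :: "'n set" and A :: "real ^ 'n ^ 'n"
    using that
  proof (induction S arbitrary: A)
    case empty
    then have diag: "A $ i $ j = 0" if "i \<noteq> j" for i j
      using that by simp
    note pos = symmetric_positive_definite_diagonal_pos[OF empty(1)]
    have "det A > 0"
      using pos by (simp add: det_diagonal[OF diag] prod_pos)
    with nn_integral_diagonal_form[OF diag pos h] show ?case by simp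
  next
    case (insert k S)
    have sym: "A $ j $ i = A $ i $ j" for i j
    proof -
      have "transpose A $ i $ j = A $ i $ j"
        using insert.prems(1) by (simp add: symmetric_positive_definite_def)
      then show ?thesis by (simp add: transpose_def)
    qed
    have kk: "A $ k $ k > 0"
      by (rule symmetric_positive_definite_diagonal_pos[OF insert.prems(1)])
    \<comment> \<open>The shear \<open>x \<mapsto> x + \<phi>(x) e\<^sub>k\<close> completes the square in the \<open>k\<close>-th variable.\<close>
    define \<phi> where "\<phi> x = x $ k - (A *v x) $ k / A $ k $ k" for x
    \<comment> \<open>For j other than k, \<open>v $ j\<close> is
      \<open>- A $ k $ j / A $ k $ k\<close>, and \<open>v $ k\<close> is 0. Thus
      \<open>\<phi>\<close> is the linear form given by \<open>v\<close>, it ignores the k-th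
      coordinate, and \<open>E\<close> is the matrix of the shear.\<close>
    define v :: "real ^ 'n" where "v = axis k 1 - (1 / A $ k $ k) *\<^sub>R A $ k"
    define E :: "real ^ 'n ^ 'n" where "E = (\<chi> i. if i = k then axis k 1 + v else axis i 1)"
    have axis_if: "axis i (1 :: real) $ j = (if j = i then 1 else 0)" for i j :: 'n
      by (simp add: axis_def)
    have \<phi>v: "\<phi> x = v \<bullet> x" for x
      by (simp add: \<phi>_def v_def inner_diff_left inner_axis' matrix_vector_mul_component)
    have E: "E *v x = x + \<phi> x *\<^sub>R axis k 1" for x
      by (auto simp: vec_eq_iff matrix_vector_mul_component E_def \<phi>v inner_axis' inner_add_left axis_if)
    have "v $ k = 0"
      using kk by (simp add: v_def)
    then have det_E: "det E = 1"
      unfolding E_def by (rule det_elementary_row)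
    have \<phi>_inv: "\<phi> (x + c *\<^sub>R axis k 1) = \<phi> x" for x c
      using \<open>v $ k = 0\<close> by (simp add: \<phi>v inner_add_right inner_axis)
    have E0: "E *v x \<noteq> 0" if "x \<noteq> 0" for x
      using det_E that by (metis invertible_det_nz matrix_left_invertible_ker invertible_left_inverse zero_neq_one)
    define B where "B = transpose E ** A ** E"
    have B: "x \<bullet> (B *v y) = (E *v x) \<bullet> (A *v (E *v y))" for x y
      unfolding B_def
      by (metis dot_lmul_matrix matrix_vector_mul_assoc transpose_matrix_vector inner_commute)
    have "transpose A = A"
      using insert.prems(1) by (simp add: symmetric_positive_definite_def)
    then have "transpose B = B"
      by (simp add: B_def matrix_transpose_mul matrix_mul_assoc)
    moreover have "x \<bullet> (B *v x) > 0" if "x \<noteq> 0" for x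
      using insert.prems(1) E0[OF that] by (simp add: B symmetric_positive_definite_def)
    ultimately have spd_B: "symmetric_positive_definite B"
      by (simp add: symmetric_positive_definite_def)
    have entry: "M $ i $ j = axis i 1 \<bullet> (M *v axis j 1)" for M :: "real ^ 'n ^ 'n" and i j
      by (simp add: inner_axis' matrix_vector_mul_component inner_axis)
    have E_axis: "E *v axis j 1 = axis j 1 + v $ j *\<^sub>R axis k 1" for j
      by (simp add: E \<phi>v inner_axis)
    have B_entry: "B $ i $ j = A $ i $ j + v $ j * A $ i $ k + v $ i * (A $ k $ j + v $ j * A $ k $ k)" for i j
      unfolding entry[of B] entry[of A] B E_axis
      by (simp add: matrix_vector_right_distrib matrix_vector_mult_scaleR inner_add_left inner_add_right algebra_simps)
    \<comment> \<open>Row k vanishes off the diagonal by the choice of \<open>v\<close>. A row i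
      that was already clear stays clear: \<open>A $ i $ k\<close> is 0, hence by symmetry so are
      \<open>A $ k $ i\<close> and \<open>v $ i\<close>.\<close>
    have "B $ i $ j = 0" if "i \<notin> S" "j \<noteq> i" for i j
    proof (cases "i = k")
      case True
      with that kk show ?thesis
        by (simp add: B_entry \<open>v $ k = 0\<close>) (simp add: v_def axis_if)
    next
      case False
      with that insert.prems(2)[of i] have "A $ i $ j = 0" "A $ i $ k = 0" by auto
      with False show ?thesis
        by (simp add: B_entry v_def axis_if sym[of k i])
    qed
    note IH = insert.IH[OF spd_B this]
    have det_B: "det B = det A"
      by (simp add: B_def det_mul det_E)
    have [measurable]: "(\<lambda>x. A *v x) \<in> borel_measurable borel"
      by (intro borel_measurable_continuous_onI matrix_vector_mult_linear_continuous_on)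
    have [measurable]: "\<phi> \<in> borel_measurable borel"
      unfolding \<phi>v[abs_def] by measurable
    have "(\<integral>\<^sup>+x. h (x \<bullet> (B *v x)) \<partial>lborel) =
        (\<integral>\<^sup>+x. h ((x + \<phi> x *\<^sub>R axis k 1) \<bullet> (A *v (x + \<phi> x *\<^sub>R axis k 1))) \<partial>lborel)"
      by (simp only: B E)
    also have "\<dots> = (\<integral>\<^sup>+x. h (x \<bullet> (A *v x)) \<partial>lborel)"
      by (rule nn_integral_lborel_shear[where f = "\<lambda>x. h (x \<bullet> (A *v x))"])
        (auto simp: axis_in_Basis_iff \<phi>_inv)
    finally show ?case
      using IH by (simp add: det_B)
  qed
  \<comment> \<open>With all indices in \<open>S\<close> the condition on the rows is
    vacuous.\<close>
  from this[of UNIV A] assms(1) show ?thesis by simp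
qed

section \<open>Radial integrals\<close>

text \<open>The image of Lebesgue measure under the squared norm gives the interval below u the
  volume of a ball of radius \<open>sqrt u\<close>, which is
  \<open>unit_ball_vol n * u powr (n / 2)\<close>. Differentiating in u gives the density on the
  right.\<close>

lemma nn_integral_lborel_radial:
  fixes h :: "real \<Rightarrow> ennreal"
  assumes [measurable]: "h \<in> borel_measurable borel"
  defines "n \<equiv> real DIM('a::euclidean_space)"
  shows "(\<integral>\<^sup>+x. h ((x::'a) \<bullet> x) \<partial>lborel) =
    (\<integral>\<^sup>+u\<in>{0<..}. ennreal (pi powr (n / 2) / Gamma (n / 2) * u powr (n / 2 - 1)) * h u \<partial>lborel)"
proof -
  define c where "c = pi powr (n / 2) / Gamma (n / 2)"
  define w where "w = (\<lambda>u. indicator {0<..} u * (c * u powr (n / 2 - 1)))"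
  have n: "n > 0" by (simp add: n_def)
  have w_meas [measurable]: "w \<in> borel_measurable borel"
    unfolding w_def by measurable
  have c: "c > 0" using n by (simp add: c_def Gamma_real_pos)
  \<comment> \<open>\<open>unit_ball_vol\<close> contains Gamma (n/2 + 1), which the functional
    equation reduces to n/2 times Gamma (n/2).\<close>
  have vol: "unit_ball_vol n = 2 * c / n"
  proof -
    have "n / 2 \<notin> \<int>\<^sub>\<le>\<^sub>0"
      using n by (auto elim!: nonpos_Ints_cases)
    show ?thesis
      by (simp only: unit_ball_vol_def c_def Gamma_plus1[OF \<open>n / 2 \<notin> \<int>\<^sub>\<le>\<^sub>0\<close>]) (simp add: mult_ac)
  qed
  \<comment> \<open>The sign makes the sets \<open>{y<..}\<close> of finite measure.\<close>
  let ?M = "distr (lborel :: 'a measure) borel (\<lambda>x. - (x \<bullet> x))"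
  let ?N = "distr (density lborel w) borel uminus"
  have M: "emeasure ?M {y<..} = ennreal (unit_ball_vol n * (if y < 0 then (- y) powr (n / 2) else 0))" for y
  proof (cases "y < 0")
    case True
    have "(\<lambda>x::'a. - (x \<bullet> x)) -` {y<..} = ball 0 (sqrt (- y))"
      by (auto simp: norm_eq_sqrt_inner)
    moreover have "sqrt (- y) ^ DIM('a) = (- y) powr (n / 2)"
      using True by (simp add: n_def powr_half_sqrt[symmetric] powr_powr flip: powr_realpow)
    ultimately show ?thesis
      using True by (simp add: emeasure_distr emeasure_ball n_def)
  next
    case False
    have "x \<bullet> x \<ge> 0" for x :: 'a by simp
    then have "(\<lambda>x::'a. - (x \<bullet> x)) -` {y<..} = {}"
      using False by (smt (verit) Collect_empty_eq greaterThan_iff vimage_def)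
    then show ?thesis
      using False by (simp add: emeasure_distr)
  qed
  have N: "emeasure ?N {y<..} = ennreal (unit_ball_vol n * (if y < 0 then (- y) powr (n / 2) else 0))" for y
  proof -
    have "emeasure ?N {y<..} = (\<integral>\<^sup>+u. ennreal (w u) * indicator {..<- y} u \<partial>lborel)"
    proof -
      have "uminus -` {y<..} = {..<- y}" by auto
      then show ?thesis by (simp add: emeasure_distr emeasure_density)
    qed
    also have "\<dots> = ennreal (unit_ball_vol n * (if y < 0 then (- y) powr (n / 2) else 0))"
    proof (cases "y < 0")
      case True
      have "((\<lambda>u. u powr (n / 2 - 1)) has_integral ((- y) powr (n / 2 - 1 + 1) / (n / 2 - 1 + 1))) {0..- y}"
        using n True by (intro has_integral_powr_from_0) auto
      then have *: "((\<lambda>u. c * u powr (n / 2 - 1)) has_integral (c * ((- y) powr (n / 2) / (n / 2)))) {0..- y}"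
        by (intro has_integral_mult_right) simp
      have "(\<integral>\<^sup>+u. ennreal (w u) * indicator {..<- y} u \<partial>lborel)
          = (\<integral>\<^sup>+u. ennreal (indicator {0..- y} u * (c * u powr (n / 2 - 1))) \<partial>lborel)"
        using AE_lborel_singleton[of "- y"] AE_lborel_singleton[of 0]
        by (intro nn_integral_cong_AE) (auto simp: w_def split: split_indicator)
      also have "\<dots> = ennreal (c * ((- y) powr (n / 2) / (n / 2)))"
        using c by (intro nn_integral_has_integral_lebesgue[OF _ *]) auto
      finally show ?thesis
        using True n by (simp add: vol mult_ac)
    next
      case False
      then have "(\<integral>\<^sup>+u. ennreal (w u) * indicator {..<- y} u \<partial>lborel) = (\<integral>\<^sup>+u. 0 \<partial>(lborel :: real measure))"
        by (intro nn_integral_cong) (auto simp: w_def split: split_indicator)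
      with False show ?thesis by simp
    qed
    finally show ?thesis .
  qed
  \<comment> \<open>Borel measures on the line that agree on all rays \<open>{y<..}\<close>, with
    finite values there, coincide.\<close>
  have MN: "?M = ?N"
    by (rule measure_eqI_lessThan) (simp_all only: M N sets_distr, simp_all)
  have "(\<integral>\<^sup>+x. h ((x::'a) \<bullet> x) \<partial>lborel) = (\<integral>\<^sup>+y. h (- y) \<partial>?M)"
    by (simp add: nn_integral_distr)
  also have "\<dots> = (\<integral>\<^sup>+u. ennreal (w u) * h u \<partial>lborel)"
    unfolding MN by (simp add: nn_integral_distr nn_integral_density)
  also have "\<dots> = (\<integral>\<^sup>+u\<in>{0<..}. ennreal (c * u powr (n / 2 - 1)) * h u \<partial>lborel)"
    by (intro nn_integral_cong) (auto simp: w_def split: split_indicator)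
  finally show ?thesis by (simp add: c_def)
qed

section \<open>The Hurwitz--Lerch zeta function at -1\<close>

text \<open>Summation by parts writes the difference between the power series and its limit as (1 -
  x) times the power series of the errors \<open>e\<close> of the partial sums. These errors tend to
  0, and (1 - x) times a geometric series is 1.\<close>

lemma Abel_limit:
  fixes a :: "nat \<Rightarrow> real"
  assumes "summable a"
  shows "((\<lambda>x. \<Sum>k. a k * x ^ k) \<longlongrightarrow> suminf a) (at_left 1)"
proof -
  define e where "e n = (\<Sum>k\<le>n. a k) - suminf a" for n
  have e_lim: "e \<longlonglongrightarrow> 0"
    unfolding e_def using summable_LIMSEQ'[OF assms] by (rule LIM_zero)
  then obtain K where K: "\<And>n. \<bar>e n\<bar> \<le> K"
    by (metis Bseq_def convergentI convergent_imp_Bseq real_norm_def)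
  have e_sum: "summable (\<lambda>k. e k * x ^ k)" if "0 \<le> x" "x < 1" for x
  proof (rule summable_comparison_test')
    show "summable (\<lambda>k. K * x ^ k)"
      using that by (intro summable_mult summable_geometric) simp
    show "norm (e k * x ^ k) \<le> K * x ^ k" if "k \<ge> 0" for k
      using K[of k] \<open>0 \<le> x\<close> by (simp add: abs_mult mult_right_mono)
  qed
  have repr: "(\<Sum>k. a k * x ^ k) = suminf a + (1 - x) * (\<Sum>k. e k * x ^ k)" if x: "0 \<le> x" "x < 1" for x
  proof -
    let ?F = "\<Sum>k. e k * x ^ k"
    have F: "(\<lambda>k. e k * x ^ k) sums ?F"
      using e_sum[OF x] by (rule summable_sums)
    then have "(\<lambda>k. e (Suc k) * x ^ Suc k) sums (?F - e 0)"
      by (subst sums_Suc_iff) simp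
    \<comment> \<open>The partial sums in \<open>e\<close> include their last index, so
      \<open>e (Suc k) - e k\<close> is \<open>a (Suc k)\<close>. Only the term of index 0 is left
      over, and \<open>e 0\<close> is \<open>a 0 - suminf a\<close>.\<close>
    from sums_diff[OF this sums_mult[OF F, of x]]
    have "(\<lambda>k. a (Suc k) * x ^ Suc k) sums (?F - e 0 - x * ?F)"
      by (simp add: e_def algebra_simps)
    then have "(\<lambda>k. a k * x ^ k) sums (?F - e 0 - x * ?F + a 0)"
      by (subst (asm) sums_Suc_iff) simp
    then show ?thesis
      by (simp add: sums_iff e_def algebra_simps)
  qed
  have "((\<lambda>x. (1 - x) * (\<Sum>k. e k * x ^ k)) \<longlongrightarrow> 0) (at_left 1)"
  proof (rule tendstoI)
    fix \<epsilon> :: real assume \<epsilon>: "\<epsilon> > 0"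
    then obtain N where N: "\<And>n. n \<ge> N \<Longrightarrow> \<bar>e n\<bar> < \<epsilon> / 2"
      using LIMSEQ_D[OF e_lim, of "\<epsilon> / 2"] by auto
    define C where "C = (\<Sum>k | k < N. \<bar>e k\<bar>)"
    have bound: "\<bar>(1 - x) * (\<Sum>k. e k * x ^ k)\<bar> \<le> (1 - x) * C + \<epsilon> / 2" if x: "0 \<le> x" "x < 1" for x
    proof -
      \<comment> \<open>The first \<open>N\<close> terms are bounded individually, the rest by a
        geometric series. After multiplication by 1 - x the former vanish in the limit and the
        latter contribute exactly half of the tolerance.\<close>
      define g where "g k = (if k < N then \<bar>e k\<bar> else 0) + \<epsilon> / 2 * x ^ k" for k
      have "norm (e k * x ^ k) \<le> g k" for k
      proof (cases "k < N")
        case True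
        have "\<bar>e k\<bar> * x ^ k \<le> \<bar>e k\<bar> * 1"
          using x by (intro mult_left_mono power_le_one) auto
        with True x \<epsilon> show ?thesis
          by (simp add: g_def abs_mult add_increasing2)
      next
        case False
        then show ?thesis
          using mult_right_mono[OF less_imp_le[OF N[of k]], of "x ^ k"] x by (simp add: g_def abs_mult)
      qed
      moreover have g: "g sums (C + \<epsilon> / 2 * (1 / (1 - x)))"
        unfolding g_def C_def using x
        by (intro sums_add sums_If_finite sums_mult geometric_sums) auto
      ultimately have F: "\<bar>\<Sum>k. e k * x ^ k\<bar> \<le> C + \<epsilon> / 2 * (1 / (1 - x))"
        using norm_suminf_le[of "\<lambda>k. e k * x ^ k" g] by (simp add: sums_iff)
      have "(1 - x) * \<bar>\<Sum>k. e k * x ^ k\<bar> \<le> (1 - x) * (C + \<epsilon> / 2 * (1 / (1 - x)))"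
        using x by (intro mult_left_mono F) simp
      also have "\<dots> = (1 - x) * C + \<epsilon> / 2"
        using x by (simp add: field_simps)
      finally have "(1 - x) * \<bar>\<Sum>k. e k * x ^ k\<bar> \<le> (1 - x) * C + \<epsilon> / 2" .
      then show ?thesis
        using x by (simp add: abs_mult)
    qed
    have "((\<lambda>x. (1 - x) * C + \<epsilon> / 2) \<longlongrightarrow> (1 - 1) * C + \<epsilon> / 2) (at_left 1)"
      by (intro tendsto_intros)
    then have "eventually (\<lambda>x. (1 - x) * C + \<epsilon> / 2 < \<epsilon>) (at_left 1)"
      by (rule order_tendstoD) (use \<epsilon> in simp)
    moreover have "eventually (\<lambda>x::real. x \<in> {0<..<1}) (at_left 1)"
      by (rule eventually_at_leftI[of 0]) auto
    ultimately show "eventually (\<lambda>x. dist ((1 - x) * (\<Sum>k. e k * x ^ k)) 0 < \<epsilon>) (at_left 1)"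
    proof eventually_elim
      case (elim x)
      then have "\<bar>(1 - x) * (\<Sum>k. e k * x ^ k)\<bar> < \<epsilon>"
        using bound[of x] by auto
      then show ?case by (simp add: dist_real_def)
    qed
  qed
  from tendsto_add[OF tendsto_const this, of "suminf a"]
  have "((\<lambda>x. suminf a + (1 - x) * (\<Sum>k. e k * x ^ k)) \<longlongrightarrow> suminf a) (at_left 1)"
    by simp
  moreover have "eventually (\<lambda>x. (\<Sum>k. a k * x ^ k) = suminf a + (1 - x) * (\<Sum>k. e k * x ^ k)) (at_left 1)"
    by (rule eventually_at_leftI[of 0]) (auto intro!: repr)
  ultimately show ?thesis
    by (simp add: tendsto_cong)
qed

section \<open>Gamma integrals and the expansion inside the unit disc\<close>

text \<open>Substitute t by \<open>\<beta> * t\<close> in Euler's integral. The result serves both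
  to evaluate the terms of the series and as an integrable majorant.\<close>

lemma has_bochner_integral_Gamma:
  assumes s: "s > (0::real)" and \<beta>: "\<beta> > 0"
  shows "has_bochner_integral lborel (\<lambda>t. indicator {0<..} t * (t powr (s - 1) * exp (- \<beta> * t))) (Gamma s / \<beta> powr s)"
proof (rule has_bochner_integral_nn_integral)
  have "ennreal (Gamma s) = (\<integral>\<^sup>+t. ennreal (indicator {0..} t * t powr (s - 1) / exp t) \<partial>lborel)"
    by (rule Gamma_conv_nn_integral_real[OF s])
  also have "\<dots> = \<beta> * (\<integral>\<^sup>+t. ennreal (indicator {0..} (\<beta> * t) * (\<beta> * t) powr (s - 1) / exp (\<beta> * t)) \<partial>lborel)"
    using \<beta> by (subst nn_integral_real_affine[where c = \<beta> and t = 0]) auto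
  also have "(\<integral>\<^sup>+t. ennreal (indicator {0..} (\<beta> * t) * (\<beta> * t) powr (s - 1) / exp (\<beta> * t)) \<partial>lborel) =
      (\<integral>\<^sup>+t. ennreal (\<beta> powr (s - 1)) * ennreal (indicator {0<..} t * (t powr (s - 1) * exp (- \<beta> * t))) \<partial>lborel)"
    using AE_lborel_singleton[of 0] \<beta>
    by (intro nn_integral_cong_AE)
      (auto simp: powr_mult exp_minus field_simps zero_le_mult_iff split: split_indicator simp flip: ennreal_mult')
  also have "\<dots> = ennreal (\<beta> powr (s - 1)) * (\<integral>\<^sup>+t. ennreal (indicator {0<..} t * (t powr (s - 1) * exp (- \<beta> * t))) \<partial>lborel)"
    by (rule nn_integral_cmult) simp
  finally have "ennreal (Gamma s) = ennreal (\<beta> powr s) * (\<integral>\<^sup>+t. ennreal (indicator {0<..} t * (t powr (s - 1) * exp (- \<beta> * t))) \<partial>lborel)"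
    using \<beta> by (simp add: powr_diff flip: mult.assoc ennreal_mult')
  then have "ennreal (1 / \<beta> powr s) * ennreal (Gamma s) = (\<integral>\<^sup>+t. ennreal (indicator {0<..} t * (t powr (s - 1) * exp (- \<beta> * t))) \<partial>lborel)"
    using \<beta> by (simp flip: mult.assoc ennreal_mult')
  then show "(\<integral>\<^sup>+t. ennreal (indicator {0<..} t * (t powr (s - 1) * exp (- \<beta> * t))) \<partial>lborel) = ennreal (Gamma s / \<beta> powr s)"
    using s by (simp flip: ennreal_mult')
qed (use s in \<open>auto simp: Gamma_real_pos order_less_imp_le split: split_indicator\<close>)

text \<open>This is the binomial series with exponent -r: the signs of the binomial coefficients
  cancel against those of the powers of -y, and \<open>Gamma (r + real k)\<close> is Gamma r times a
  Pochhammer symbol.\<close>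

lemma Gamma_binomial_series:
  assumes r: "r > (0 :: real)" and y: "\<bar>y\<bar> < 1"
  shows "(\<lambda>k. Gamma (r + real k) / fact k * y ^ k) sums (Gamma r / (1 - y) powr r)"
proof -
  have "r \<notin> \<int>\<^sub>\<le>\<^sub>0"
    using r by (auto elim!: nonpos_Ints_cases)
  then have *: "Gamma (r + real k) = Gamma r * pochhammer r k" for k
    using pochhammer_Gamma[of r k] r by (simp add: Gamma_eq_zero_iff)
  have "(- r gchoose k) * (- y) ^ k = pochhammer r k / fact k * y ^ k" for k
    by (cases "even k") (simp_all add: gbinomial_pochhammer)
  with gen_binomial_real[of "- y" "- r"] y
  have "(\<lambda>k. pochhammer r k / fact k * y ^ k) sums (1 - y) powr - r"
    by simp
  from sums_mult[OF this, of "Gamma r"] show ?thesis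
    by (simp add: * powr_minus field_simps)
qed

text \<open>A real counterpart of the integrand in \<open>HL_zeta\<close>: for t > 0 and z at most 1
  all bases of powers are positive. The indicator is built in so that integrals run over the whole
  line.\<close>

definition HL_integrand :: "real \<Rightarrow> real \<Rightarrow> real \<Rightarrow> real \<Rightarrow> real \<Rightarrow> real" where
  "HL_integrand r s \<alpha> z t =
    indicator {0<..} t * (t powr (s - 1) * exp (- \<alpha> * t) / (1 - z * exp (- t)) powr r)"

lemma HL_integrand_measurable [measurable]: "HL_integrand r s \<alpha> z \<in> borel_measurable borel"
  unfolding HL_integrand_def by measurable

text \<open>Expand the denominator by the binomial series and integrate term by term; the k-th term
  is a Gamma integral with rate k + \<open>\<alpha>\<close>. The interchange rests on absolute
  convergence, which holds inside the unit disc but can fail at z = -1.\<close>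

lemma HL_series_integral:
  assumes r: "r > 0" and s: "s > 0" and \<alpha>: "\<alpha> > 0" and z: "\<bar>z\<bar> < 1"
  shows "(\<lambda>k. Gamma (r + real k) / fact k * (z ^ k / (real k + \<alpha>) powr s)) sums
    (Gamma r / Gamma s * (\<integral>t. HL_integrand r s \<alpha> z t \<partial>lborel))"
proof -
  define c where "c k = Gamma (r + real k) / fact k" for k
  define q where "q k t = indicator {0<..} t * (t powr (s - 1) * exp (- (real k + \<alpha>) * t))" for k and t :: real
  have c: "c k > 0" for k
    using r by (simp add: c_def Gamma_real_pos)
  have q: "has_bochner_integral lborel (q k) (Gamma s / (real k + \<alpha>) powr s)" for k
    unfolding q_def using s \<alpha> by (intro has_bochner_integral_Gamma) auto
  have q_nonneg: "q k t \<ge> 0" for k t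
    by (simp add: q_def)
  have q_eq: "q k t = q 0 t * exp (- t) ^ k" for k t
    by (simp add: q_def algebra_simps flip: exp_add exp_of_nat_mult)
  have exp_bound: "\<bar>y * exp (- t)\<bar> < 1" if "\<bar>y\<bar> < 1" "t > 0" for y t :: real
  proof -
    have "\<bar>y\<bar> * exp (- t) \<le> \<bar>y\<bar> * 1"
      using that by (intro mult_left_mono) auto
    with that show ?thesis by (simp add: abs_mult)
  qed
  \<comment> \<open>The argument y is general because the series is needed at z for the value and at
    |z| for absolute convergence.\<close>
  have series: "(\<lambda>k. c k * y ^ k * q k t) sums (Gamma r * HL_integrand r s \<alpha> y t)" if "\<bar>y\<bar> < 1" for y t
  proof (cases "t > 0")
    case True
    have trm: "q 0 t * (c k * (y * exp (- t)) ^ k) = c k * y ^ k * q k t" for k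
      by (subst q_eq[of k]) (simp add: power_mult_distrib)
    have "q 0 t * (Gamma r / (1 - y * exp (- t)) powr r) = Gamma r * HL_integrand r s \<alpha> y t"
      using True by (simp add: HL_integrand_def q_def)
    with sums_mult[OF Gamma_binomial_series[OF r exp_bound[OF that True]], of "q 0 t"]
    show ?thesis
      by (simp only: trm flip: c_def)
  qed (simp add: q_def HL_integrand_def)
  have "(\<lambda>k. \<integral>t. c k * z ^ k * q k t \<partial>lborel) sums (\<integral>t. (\<Sum>k. c k * z ^ k * q k t) \<partial>lborel)"
  proof (rule sums_integral)
    show "integrable lborel (\<lambda>t. c k * z ^ k * q k t)" for k
      using q[of k] by (auto simp: has_bochner_integral_iff)
    have abs: "norm (c k * z ^ k * q k t) = c k * \<bar>z\<bar> ^ k * q k t" for k t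
      using c[of k] q_nonneg[of k t] by (simp add: abs_mult power_abs)
    show "AE t in lborel. summable (\<lambda>k. norm (c k * z ^ k * q k t))"
      unfolding abs using series[of "\<bar>z\<bar>"] z by (auto simp: sums_iff)
    have "(\<integral>t. norm (c k * z ^ k * q k t) \<partial>lborel) = c k * \<bar>z\<bar> ^ k * (Gamma s / (real k + \<alpha>) powr s)" for k
      unfolding abs using q[of k] by (simp add: has_bochner_integral_iff)
    moreover have "summable (\<lambda>k. c k * \<bar>z\<bar> ^ k * (Gamma s / (real k + \<alpha>) powr s))"
    \<comment> \<open>Replacing k + \<open>\<alpha>\<close> by \<open>\<alpha>\<close> only enlarges
      the terms and leaves a multiple of the binomial series at |z|.\<close>
    proof (rule summable_comparison_test')
      show "summable (\<lambda>k. c k * \<bar>z\<bar> ^ k * (Gamma s / \<alpha> powr s))"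
        using Gamma_binomial_series[OF r, of "\<bar>z\<bar>"] z
        by (intro summable_mult2) (auto simp: sums_iff c_def)
      fix k :: nat
      have "Gamma s / (real k + \<alpha>) powr s \<le> Gamma s / \<alpha> powr s"
        using s \<alpha> by (intro divide_left_mono powr_mono2) (auto simp: Gamma_real_pos order_less_imp_le)
      then have "c k * \<bar>z\<bar> ^ k * (Gamma s / (real k + \<alpha>) powr s) \<le> c k * \<bar>z\<bar> ^ k * (Gamma s / \<alpha> powr s)"
        using c[of k] by (intro mult_left_mono) simp_all
      moreover have "0 \<le> c k * \<bar>z\<bar> ^ k * (Gamma s / (real k + \<alpha>) powr s)"
        using c[of k] Gamma_real_pos[OF s] by (simp add: order_less_imp_le)
      ultimately show "norm (c k * \<bar>z\<bar> ^ k * (Gamma s / (real k + \<alpha>) powr s)) \<le> c k * \<bar>z\<bar> ^ k * (Gamma s / \<alpha> powr s)"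
        by simp
    qed
    ultimately show "summable (\<lambda>k. \<integral>t. norm (c k * z ^ k * q k t) \<partial>lborel)"
      by simp
  qed
  moreover have "(\<integral>t. c k * z ^ k * q k t \<partial>lborel) = Gamma s * (c k * (z ^ k / (real k + \<alpha>) powr s))" for k
    using q[of k] by (simp add: has_bochner_integral_iff)
  moreover have "(\<integral>t. (\<Sum>k. c k * z ^ k * q k t) \<partial>lborel) = Gamma r * (\<integral>t. HL_integrand r s \<alpha> z t \<partial>lborel)"
    using series[OF z] by (simp add: sums_iff)
  ultimately have "(\<lambda>k. Gamma s * (c k * (z ^ k / (real k + \<alpha>) powr s))) sums
      (Gamma r * (\<integral>t. HL_integrand r s \<alpha> z t \<partial>lborel))"
    by simp
  from sums_divide[OF this, of "Gamma s"] show ?thesis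
    using s Gamma_real_pos[OF s] by (simp add: c_def)
qed

section \<open>Approach to -1 along the real axis\<close>

text \<open>At -x with nonnegative x the denominator is at least 1, so the Gamma integrand is a
  majorant that does not depend on x. This permits dominated convergence as x tends to 1.\<close>

lemma HL_integrand_minus_bound:
  assumes "0 \<le> x" "r \<ge> 0"
  shows "0 \<le> HL_integrand r s \<alpha> (- x) t"
    and "HL_integrand r s \<alpha> (- x) t \<le> indicator {0<..} t * (t powr (s - 1) * exp (- \<alpha> * t))"
proof -
  have "1 \<le> (1 + x * exp (- t)) powr r"
    using assms by (intro ge_one_powr_ge_zero) auto
  then show "HL_integrand r s \<alpha> (- x) t \<le> indicator {0<..} t * (t powr (s - 1) * exp (- \<alpha> * t))"
    by (auto simp: HL_integrand_def divide_le_eq split: split_indicator intro!: mult_right_mono mult_left_mono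
        order.trans[OF _ mult_left_mono[of 1]])
  show "0 \<le> HL_integrand r s \<alpha> (- x) t"
    by (simp add: HL_integrand_def)
qed

lemma HL_integrand_integrable:
  assumes "0 \<le> x" "r \<ge> 0" "s > 0" "\<alpha> > 0"
  shows "integrable lborel (HL_integrand r s \<alpha> (- x))"
proof (rule Bochner_Integration.integrable_bound)
  show "integrable lborel (\<lambda>t. indicator {0<..} t * (t powr (s - 1) * exp (- \<alpha> * t)))"
    using has_bochner_integral_Gamma[OF assms(3,4)] by (simp add: has_bochner_integral_iff)
  show "AE t in lborel. norm (HL_integrand r s \<alpha> (- x) t)
      \<le> norm (indicator {0<..} t * (t powr (s - 1) * exp (- \<alpha> * t)))"
    using HL_integrand_minus_bound[OF assms(1,2)] by (auto simp: abs_of_nonneg)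
qed simp

lemma HL_integral_LIMSEQ:
  assumes x: "\<And>m. 0 \<le> x m" "x \<longlonglongrightarrow> 1" and pos: "r > 0" "s > 0" "\<alpha> > 0"
  shows "(\<lambda>m. \<integral>t. HL_integrand r s \<alpha> (- x m) t \<partial>lborel) \<longlonglongrightarrow> (\<integral>t. HL_integrand r s \<alpha> (- 1) t \<partial>lborel)"
proof (rule integral_dominated_convergence)
  show "integrable lborel (\<lambda>t. indicator {0<..} t * (t powr (s - 1) * exp (- \<alpha> * t)))"
    using has_bochner_integral_Gamma[OF pos(2,3)] by (simp add: has_bochner_integral_iff)
  show "AE t in lborel. norm (HL_integrand r s \<alpha> (- x m) t)
      \<le> indicator {0<..} t * (t powr (s - 1) * exp (- \<alpha> * t))" for m
    using HL_integrand_minus_bound[of "x m" r] x pos by (auto simp: abs_of_nonneg)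
  have "(\<lambda>m. HL_integrand r s \<alpha> (- x m) t) \<longlonglongrightarrow> HL_integrand r s \<alpha> (- 1) t" for t
  proof -
    have "1 - - 1 * exp (- t) \<noteq> (0 :: real)"
      using exp_gt_zero[of "- t"] by (smt (verit))
    then show ?thesis
      unfolding HL_integrand_def by (intro tendsto_intros x) simp_all
  qed
  then show "AE t in lborel. (\<lambda>m. HL_integrand r s \<alpha> (- x m) t) \<longlonglongrightarrow> HL_integrand r s \<alpha> (- 1) t"
    by simp
qed simp_all

text \<open>The two branches of \<open>HL_zeta\<close> have to be reconciled. The divergent one is
  the integral by definition; in the other the convergence may be conditional, so the value is
  obtained as a limit from inside the disc.\<close>

lemma HL_zeta_minus_one:
  assumes r: "r > 0" and s: "s > 0" and \<alpha>: "\<alpha> > 0"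
  shows "HL_zeta (of_real r) (- 1) (of_real s) (of_real \<alpha>) =
    of_real (1 / Gamma s * (\<integral>t. HL_integrand r s \<alpha> (- 1) t \<partial>lborel))"
proof -
  define b where "b k = Gamma (r + real k) / fact k * ((- 1) ^ k / (real k + \<alpha>) powr s)" for k
  have "HL_term (of_real r) (- 1) (of_real s) (of_real \<alpha>) k = of_real (b k)" for k
  proof -
    have "Gamma (of_real r + of_nat k :: complex) = of_real (Gamma (r + real k))"
      using Gamma_complex_of_real[of "r + real k"] by simp
    moreover have "(of_nat k + of_real \<alpha> :: complex) powr of_real s = of_real ((real k + \<alpha>) powr s)"
      using powr_of_real[of "real k + \<alpha>" s] \<alpha> by simp
    ultimately show ?thesis by (simp add: HL_term_def b_def)
  qed
  then have b: "HL_term (of_real r) (- 1) (of_real s) (of_real \<alpha>) = (\<lambda>k. of_real (b k))"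
    by (rule ext)
  show ?thesis
  proof (cases "summable b")
    case True
    \<comment> \<open>Any sequence increasing to 1 from below would do. Absorbing
      \<open>x m ^ k\<close> into the sign makes the argument \<open>- x m\<close>, which lies
      inside the unit disc.\<close>
    define x where "x m = real m / real (Suc m)" for m
    have x: "0 \<le> x m" "x m < 1" for m
      by (auto simp: x_def divide_simps)
    have x_lim: "x \<longlonglongrightarrow> 1"
      unfolding x_def by (rule LIMSEQ_n_over_Suc_n)
    then have "filterlim x (at_left 1) sequentially"
      using x by (intro filterlim_at_withinI) (auto simp: less_imp_neq)
    with Abel_limit[OF True] have "(\<lambda>m. \<Sum>k. b k * x m ^ k) \<longlonglongrightarrow> suminf b"
      by (rule filterlim_compose)
    moreover have "(\<Sum>k. b k * x m ^ k) = Gamma r / Gamma s * (\<integral>t. HL_integrand r s \<alpha> (- x m) t \<partial>lborel)" for m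
    proof -
      have "b k * x m ^ k = Gamma (r + real k) / fact k * ((- x m) ^ k / (real k + \<alpha>) powr s)" for k
        by (simp add: b_def power_minus[of "x m"])
      with HL_series_integral[OF r s \<alpha>, of "- x m"] x[of m] show ?thesis
        by (simp add: sums_iff)
    qed
    ultimately have "(\<lambda>m. Gamma r / Gamma s * (\<integral>t. HL_integrand r s \<alpha> (- x m) t \<partial>lborel)) \<longlonglongrightarrow> suminf b"
      by simp
    moreover have "(\<lambda>m. Gamma r / Gamma s * (\<integral>t. HL_integrand r s \<alpha> (- x m) t \<partial>lborel))
        \<longlonglongrightarrow> Gamma r / Gamma s * (\<integral>t. HL_integrand r s \<alpha> (- 1) t \<partial>lborel)"
      by (intro tendsto_mult_left HL_integral_LIMSEQ x x_lim r s \<alpha>)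
    ultimately have "suminf b = Gamma r / Gamma s * (\<integral>t. HL_integrand r s \<alpha> (- 1) t \<partial>lborel)"
      by (rule LIMSEQ_unique)
    moreover have "(\<Sum>k. complex_of_real (b k)) = of_real (suminf b)"
      using True by (rule suminf_of_real[symmetric])
    ultimately show ?thesis
      using True Gamma_real_pos[OF r]
      by (simp add: HL_zeta_def b summable_of_real Gamma_complex_of_real)
  next
    case False
    \<comment> \<open>All bases are positive reals, so the principal complex powers reduce to real
      ones.\<close>
    have "(LBINT t:{0<..}. of_real t powr (of_real s - 1) * exp (- of_real \<alpha> * of_real t) / (1 - - 1 * exp (- of_real t)) powr of_real r)
        = (LBINT t:{0<..}. complex_of_real (HL_integrand r s \<alpha> (- 1) t))"
    proof (intro set_lebesgue_integral_cong allI impI)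
      fix t :: real assume "t \<in> {0<..}"
      moreover have "(1 - - 1 * exp (- complex_of_real t)) powr of_real r = of_real ((1 + exp (- t)) powr r)"
        using powr_of_real[of "1 + exp (- t)" r] by (simp add: exp_of_real[symmetric])
      moreover have "complex_of_real t powr (of_real s - 1) = of_real (t powr (s - 1))" if "t > 0"
        using powr_of_real[of t "s - 1"] that by simp
      moreover have "exp (- complex_of_real \<alpha> * of_real t) = of_real (exp (- \<alpha> * t))"
        by (simp flip: exp_of_real)
      ultimately show "of_real t powr (of_real s - 1) * exp (- of_real \<alpha> * of_real t) / (1 - - 1 * exp (- of_real t)) powr of_real r
          = complex_of_real (HL_integrand r s \<alpha> (- 1) t)"
        by (simp add: HL_integrand_def)
    qed simp
    also have "\<dots> = of_real (\<integral>t. HL_integrand r s \<alpha> (- 1) t \<partial>lborel)"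
      by (simp only: set_integral_complex_of_real set_lebesgue_integral_def HL_integrand_def)
        (auto intro!: Bochner_Integration.integral_cong split: split_indicator)
    finally show ?thesis
      using False by (simp add: HL_zeta_def b Gamma_complex_of_real)
  qed
qed

text \<open>Since \<open>exp (- t)\<close> is below 1 for t > 0, the denominator is at most
  \<open>2 powr r\<close>, and a positive multiple of the Gamma integrand is a lower bound.
  Positivity is what later allows division by this integral.\<close>

lemma HL_integral_pos:
  assumes "r > 0" and s: "s > 0" and \<alpha>: "\<alpha> > 0"
  shows "(\<integral>t. HL_integrand r s \<alpha> (- 1) t \<partial>lborel) > 0"
proof -
  let ?q = "\<lambda>t. indicator {0<..} t * (t powr (s - 1) * exp (- \<alpha> * t))"
  have q: "has_bochner_integral lborel ?q (Gamma s / \<alpha> powr s)"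
    using s \<alpha> by (rule has_bochner_integral_Gamma)
  have "0 < 1 / 2 powr r * (Gamma s / \<alpha> powr s)"
    using s \<alpha> by (simp add: Gamma_real_pos)
  also have "\<dots> = (\<integral>t. 1 / 2 powr r * ?q t \<partial>lborel)"
    using q by (simp add: has_bochner_integral_iff)
  also have "\<dots> \<le> (\<integral>t. HL_integrand r s \<alpha> (- 1) t \<partial>lborel)"
  proof (rule integral_mono)
    show "integrable lborel (\<lambda>t. 1 / 2 powr r * ?q t)"
      using q by (intro integrable_mult_right) (simp add: has_bochner_integral_iff)
    show "integrable lborel (HL_integrand r s \<alpha> (- 1))"
      using HL_integrand_integrable[of 1 r s \<alpha>] assms by simp
    show "1 / 2 powr r * ?q t \<le> HL_integrand r s \<alpha> (- 1) t" for t
    proof (cases "t > 0")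
      case True
      then have "(1 + exp (- t)) powr r \<le> 2 powr r"
        using assms by (intro powr_mono2) (auto simp: add_pos_pos)
      then have "t powr (s - 1) * exp (- \<alpha> * t) / 2 powr r \<le> t powr (s - 1) * exp (- \<alpha> * t) / (1 + exp (- t)) powr r"
        by (intro divide_left_mono) (auto simp: add_pos_pos less_imp_neq[symmetric])
      with True show ?thesis by (simp add: HL_integrand_def)
    qed (simp add: HL_integrand_def)
  qed
  finally show ?thesis .
qed

section \<open>The normalizing constant\<close>

text \<open>The density involves the form of the inverse matrix, so the reduction above is applied
  to that. Positivity follows by setting y = \<open>matrix_inv A *v x\<close>, for which the form of
  the inverse at x equals the form of \<open>A\<close> at y.\<close>

lemma symmetric_positive_definite_inverse:
  assumes "symmetric_positive_definite A"
  shows "symmetric_positive_definite (matrix_inv A)" and "det (matrix_inv A) = 1 / det A"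
proof -
  have sym: "transpose A = A" and pos: "\<And>x. x \<noteq> 0 \<Longrightarrow> x \<bullet> (A *v x) > 0"
    using assms by (auto simp: symmetric_positive_definite_def)
  have "x = 0" if "A *v x = 0" for x
    using pos[of x] that by force
  then have inv: "invertible A"
    by (simp add: invertible_left_inverse matrix_left_invertible_ker)
  have AB: "A ** matrix_inv A = mat 1"
    using someI_ex[OF inv[unfolded invertible_def]] by (simp add: matrix_inv_def)
  have "transpose (matrix_inv A) = transpose (matrix_inv A) ** (A ** matrix_inv A)"
    by (simp add: AB)
  also have "\<dots> = transpose (A ** matrix_inv A) ** matrix_inv A"
    by (simp add: matrix_transpose_mul sym matrix_mul_assoc)
  also have "\<dots> = matrix_inv A"
    by (simp add: AB transpose_mat)
  finally have "transpose (matrix_inv A) = matrix_inv A" .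
  moreover have "x \<bullet> (matrix_inv A *v x) > 0" if "x \<noteq> 0" for x
  proof -
    let ?y = "matrix_inv A *v x"
    have x: "A *v ?y = x"
      by (simp add: matrix_vector_mul_assoc AB)
    with that have "?y \<noteq> 0" by auto
    from pos[OF this] show ?thesis by (simp add: x inner_commute)
  qed
  ultimately show "symmetric_positive_definite (matrix_inv A)"
    by (simp add: symmetric_positive_definite_def)
  have "det A * det (matrix_inv A) = 1"
    by (simp add: AB flip: det_mul)
  then show "det (matrix_inv A) = 1 / det A"
    by (metis div_by_0 mult_zero_left nonzero_mult_div_cancel_left zero_neq_one)
qed

text \<open>Substituting t = a u turns the rate b into b/a. The powers of a from
  \<open>u powr (s - 1)\<close> and from du combine to the factor
  \<open>1 / a powr s\<close>.\<close>

lemma nn_integral_logistic_generator: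
  assumes a: "a > 0" and b: "b > 0" and r: "r > 0" and s: "s > 0" and c: "c \<ge> 0"
  shows "(\<integral>\<^sup>+u\<in>{0<..}. ennreal (c * u powr (s - 1)) * ennreal (logistic_generator a b r u) \<partial>lborel)
    = ennreal (c / a powr s * (\<integral>t. HL_integrand r s (b / a) (- 1) t \<partial>lborel))"
    (is "_ = ennreal (_ * ?J)")
proof -
  have nonneg: "0 \<le> HL_integrand r s (b / a) (- 1) t" for t
    using HL_integrand_minus_bound(1)[of 1 r] r by simp
  have J: "?J \<ge> 0"
    by (intro integral_nonneg_AE) (simp add: nonneg)
  have "ennreal ?J = (\<integral>\<^sup>+t. ennreal (HL_integrand r s (b / a) (- 1) t) \<partial>lborel)"
    using HL_integrand_integrable[of 1 r s "b / a"] assms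
    by (subst nn_integral_eq_integral) (auto simp: nonneg)
  also have "\<dots> = ennreal a * (\<integral>\<^sup>+u. ennreal (HL_integrand r s (b / a) (- 1) (a * u)) \<partial>lborel)"
    using a by (subst nn_integral_real_affine[where c = a and t = 0]) auto
  finally have J_eq: "ennreal ?J = ennreal a * (\<integral>\<^sup>+u. ennreal (HL_integrand r s (b / a) (- 1) (a * u)) \<partial>lborel)" .
  have "(\<integral>\<^sup>+u\<in>{0<..}. ennreal (c * u powr (s - 1)) * ennreal (logistic_generator a b r u) \<partial>lborel)
      = (\<integral>\<^sup>+u. ennreal (c / a powr s) * (ennreal a * ennreal (HL_integrand r s (b / a) (- 1) (a * u))) \<partial>lborel)"
  proof (rule nn_integral_cong)
    fix u :: real
    have "c * u powr (s - 1) * logistic_generator a b r u = c / a powr s * (a * HL_integrand r s (b / a) (- 1) (a * u))"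
      if "u > 0"
      using that a by (simp add: logistic_generator_def HL_integrand_def powr_mult powr_diff)
    moreover have "HL_integrand r s (b / a) (- 1) (a * u) = 0" if "\<not> u > 0"
      using that a by (simp add: HL_integrand_def zero_less_mult_iff)
    ultimately show "ennreal (c * u powr (s - 1)) * ennreal (logistic_generator a b r u) * indicator {0<..} u
        = ennreal (c / a powr s) * (ennreal a * ennreal (HL_integrand r s (b / a) (- 1) (a * u)))"
      using a c by (cases "u > 0") (simp_all flip: ennreal_mult')
  qed
  also have "\<dots> = ennreal (c / a powr s) * ennreal ?J"
    by (simp add: nn_integral_cmult J_eq)
  also have "\<dots> = ennreal (c / a powr s * ?J)"
    using c by (simp flip: ennreal_mult')
  finally show ?thesis .
qed

text \<open>Translation removes the location, the quadratic form is replaced by the squared norm at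
  the cost of \<open>sqrt (det \<Sigma>)\<close>, and the radial integral is evaluated. The factor
  \<open>d\<close> may be any real, so the total mass is available before normalization.\<close>

lemma has_bochner_integral_elliptical_logistic:
  fixes \<mu> :: "real ^ 'n" and \<Sigma> :: "real ^ 'n ^ 'n"
  assumes a: "a > 0" and b: "b > 0" and r: "r > 0" and \<Sigma>: "symmetric_positive_definite \<Sigma>"
  defines "s \<equiv> real CARD('n) / 2"
  shows "has_bochner_integral lborel (elliptical_function d (logistic_generator a b r) \<mu> \<Sigma>)
    (d * ((pi / a) powr s / Gamma s * (\<integral>t. HL_integrand r s (b / a) (- 1) t \<partial>lborel)))"
proof -
  let ?J = "\<integral>t. HL_integrand r s (b / a) (- 1) t \<partial>lborel"
  let ?g = "logistic_generator a b r"
  define M where "M = matrix_inv \<Sigma>"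
  define c where "c = pi powr s / Gamma s"
  have s: "s > 0" by (simp add: s_def)
  have M: "symmetric_positive_definite M" "det M = 1 / det \<Sigma>"
    unfolding M_def by (rule symmetric_positive_definite_inverse[OF \<Sigma>])+
  have g_meas [measurable]: "?g \<in> borel_measurable borel"
    unfolding logistic_generator_def by measurable
  have M_meas [measurable]: "(\<lambda>x. M *v x) \<in> borel_measurable borel"
    by (intro borel_measurable_continuous_onI matrix_vector_mult_linear_continuous_on)
  note form = symmetric_positive_definite_nn_integral[OF M(1), of "\<lambda>u. ennreal (?g u)"]
  \<comment> \<open>The reduction for the inverse yields positivity of its determinant, hence of
    \<open>det \<Sigma>\<close>.\<close>
  have det: "det \<Sigma> > 0"
    using form by (simp add: M(2) zero_less_divide_iff)
  have "(\<integral>\<^sup>+x. ennreal (?g ((x - \<mu>) \<bullet> (M *v (x - \<mu>)))) \<partial>lborel)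
      = (\<integral>\<^sup>+x. ennreal (?g ((x - \<mu>) \<bullet> (M *v (x - \<mu>)))) \<partial>distr lborel borel ((+) \<mu>))"
    by (simp add: lborel_distr_plus)
  also have "\<dots> = (\<integral>\<^sup>+x. ennreal (?g (x \<bullet> (M *v x))) \<partial>lborel)"
    by (subst nn_integral_distr) simp_all
  also have "\<dots> = ennreal (sqrt (det \<Sigma>)) * (\<integral>\<^sup>+x. ennreal (?g ((x :: real ^ 'n) \<bullet> x)) \<partial>lborel)"
    using form by (simp add: M(2) real_sqrt_divide)
  also have "(\<integral>\<^sup>+x. ennreal (?g ((x :: real ^ 'n) \<bullet> x)) \<partial>lborel)
      = (\<integral>\<^sup>+u\<in>{0<..}. ennreal (c * u powr (s - 1)) * ennreal (?g u) \<partial>lborel)"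
    by (subst nn_integral_lborel_radial) (simp_all add: c_def s_def)
  also have "\<dots> = ennreal (c / a powr s * ?J)"
    using s by (intro nn_integral_logistic_generator a b r) (simp_all add: c_def Gamma_real_pos order_less_imp_le)
  finally have "(\<integral>\<^sup>+x. ennreal (?g ((x - \<mu>) \<bullet> (M *v (x - \<mu>)))) \<partial>lborel)
      = ennreal (sqrt (det \<Sigma>) * (c / a powr s * ?J))"
    using det by (simp flip: ennreal_mult')
  moreover have "0 \<le> sqrt (det \<Sigma>) * (c / a powr s * ?J)"
    using det s HL_integral_pos[OF r s, of "b / a"] a b
    by (simp add: c_def Gamma_real_pos order_less_imp_le)
  ultimately have "has_bochner_integral lborel (\<lambda>x. ?g ((x - \<mu>) \<bullet> (M *v (x - \<mu>))))
      (sqrt (det \<Sigma>) * (c / a powr s * ?J))"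
    by (intro has_bochner_integral_nn_integral) (auto simp: logistic_generator_def)
  from has_bochner_integral_mult_right[OF this, of "d * det \<Sigma> powr (- 1 / 2)"]
  have "has_bochner_integral lborel (elliptical_function d ?g \<mu> \<Sigma>)
      (d * det \<Sigma> powr (- 1 / 2) * (sqrt (det \<Sigma>) * (c / a powr s * ?J)))"
    by (simp add: elliptical_function_def[abs_def] M_def)
  also have "d * det \<Sigma> powr (- 1 / 2) * (sqrt (det \<Sigma>) * (c / a powr s * ?J)) = d * ((pi / a) powr s / Gamma s * ?J)"
  proof -
    have "det \<Sigma> powr (- 1 / 2) * sqrt (det \<Sigma>) = 1"
      using det by (simp add: powr_minus powr_half_sqrt minus_divide_left[symmetric])
    then have "d * det \<Sigma> powr (- 1 / 2) * (sqrt (det \<Sigma>) * (c / a powr s * ?J)) = d * (c / a powr s * ?J)"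
      by (metis mult.assoc mult.right_neutral)
    then show ?thesis
      using a by (simp add: c_def powr_divide mult_ac)
  qed
  finally show ?thesis .
qed

text \<open>The total mass is \<open>d * K\<close> with \<open>K\<close> positive, so mass 1 forces
  \<open>d\<close> to be 1/K, and this value makes the function nonnegative. The equivalence thus
  contains both existence and uniqueness of the normalizing constant.\<close>

theorem theorem2p1:
  fixes a b r d :: real
    and \<mu> :: "real ^ 'n"
    and \<Sigma> :: "real ^ 'n ^ 'n"
  assumes "a > 0" and "b > 0" and "r > 0"
    and "symmetric_positive_definite \<Sigma>"
  shows "is_pdf (elliptical_function d (logistic_generator a b r) \<mu> \<Sigma>) \<longleftrightarrow>
    complex_of_real d =
      complex_of_real ((a / pi) powr (real CARD('n) / 2)) *
      inverse (HL_zeta (of_real r) (- 1) (of_real (real CARD('n) / 2)) (of_real (b / a)))"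
proof -
  define s where "s = real CARD('n) / 2"
  define J where "J = (\<integral>t. HL_integrand r s (b / a) (- 1) t \<partial>lborel)"
  define K where "K = (pi / a) powr s / Gamma s * J"
  have s: "s > 0" by (simp add: s_def)
  have "J > 0"
    unfolding J_def using assms s by (intro HL_integral_pos) auto
  then have K: "K > 0"
    using assms s by (simp add: K_def Gamma_real_pos)
  have int: "has_bochner_integral lborel (elliptical_function d (logistic_generator a b r) \<mu> \<Sigma>) (d * K)"
    using has_bochner_integral_elliptical_logistic[OF assms] by (simp add: K_def J_def s_def)
  have "is_pdf (elliptical_function d (logistic_generator a b r) \<mu> \<Sigma>) \<longleftrightarrow> d * K = 1"
  proof
    assume "is_pdf (elliptical_function d (logistic_generator a b r) \<mu> \<Sigma>)"
    then show "d * K = 1"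
      unfolding is_pdf_def using has_bochner_integral_eq[OF int] by blast
  next
    assume dK: "d * K = 1"
    with K have "d \<ge> 0"
      by (metis less_eq_real_def linorder_not_less mult_less_0_iff not_one_less_zero zero_less_one)
    then show "is_pdf (elliptical_function d (logistic_generator a b r) \<mu> \<Sigma>)"
      using int dK by (simp add: is_pdf_def elliptical_function_def logistic_generator_def)
  qed
  also have "\<dots> \<longleftrightarrow> d = (a / pi) powr s * inverse (1 / Gamma s * J)"
  proof -
    have "(a / pi) powr s * inverse (1 / Gamma s * J) = 1 / K"
      using assms by (simp add: K_def powr_divide field_simps)
    then show ?thesis
      using K by (simp only:) (simp add: field_simps)
  qed
  \<comment> \<open>The passage to complex numbers is needed because \<open>HL_zeta\<close> is
    complex-valued; at the present arguments its value is the embedded real number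
    \<open>1 / Gamma s * J\<close>.\<close>
  also have "\<dots> \<longleftrightarrow> complex_of_real d = complex_of_real ((a / pi) powr s * inverse (1 / Gamma s * J))"
    by (rule of_real_eq_iff[symmetric])
  also have "complex_of_real ((a / pi) powr s * inverse (1 / Gamma s * J))
      = complex_of_real ((a / pi) powr s) * inverse (HL_zeta (of_real r) (- 1) (of_real s) (of_real (b / a)))"
    using assms s by (simp only: HL_zeta_minus_one J_def of_real_mult of_real_inverse divide_pos_pos)
  finally show ?thesis by (simp only: s_def)
qed

end
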